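(* Let $n\ge 1$, $\mathcal N=\{1,\ldots,n\}$, and let $w\in\mathbb R^n_{++}$, $b\in\mathbb R^n$, $c\in\mathbb R$ with $c<\sum_{i=1}^n w_i b_i$. Let (P) be the problem of minimizing $\sum_{i=1}^n w_i x_i^2$ over $x\in\mathbb R^n$ subject to $\sum_{i=1}^n w_i x_i=c$ and $x\le b$. (1) Under the change of variables $$\overline z_i=w_i(b_i-x_i),\quad i\in\mathcal N,$$ problem (P) is equivalent to $$\min_{\overline z\in\mathbb R^n}\ \frac12\sum_{i=1}^n\overline w_i(\overline z_i-\overline y_i)^2\quad\text{s.t.}\quad \sum_{i=1}^n\overline z_i=a,\quad \overline z\ge 0,$$ where $\overline w_i=1/w_i$, $\overline y_i=w_i b_i$ and $a=\sum_{i=1}^n w_i b_i-c>0$. That is, the transformation is a bijection between the feasible sets of the two problems and preserves optimality. (2) Moreover, let $p,q\in\mathbb R^n$ with $p_i>0$ for all $i\in\mathcal N$, and let (CSP) be the problem of minimizing $\sum_{i=1}^n p_i z_i^2+\sum_{i=1}^n q_i z_i$ over $z\in\mathbb R^n$ subject to $\sum_{i=1}^n z_i=1$ and $z\ge 0$. Then (CSP) is equivalent to problem (P) with the data $$w_i=\frac1{2p_i},\quad b_i=-q_i,\quad c=-1-\sum_{i=1}^n\frac{q_i}{2p_i},$$ under the change of variables $$x_i=-q_i-2p_i z_i,\quad i\in\mathcal N .$$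
   Context: $\mathbb R^n_{++}$ denotes the set of vectors with strictly positive entries; vector inequalities are componentwise. Two minimization problems are equivalent under a change of variables if the change of variables is a bijection between their feasible sets that maps optimal solutions of one problem onto optimal solutions of the other. *)

theory Defs
  imports "HOL-Analysis.Analysis"
begin

text \<open>A minimization problem is a pair of a feasible set and a real-valued objective.\<close>

type_synonym 'a min_problem = "'a set \<times> ('a \<Rightarrow> real)"

definition optimal_solutions :: "'a min_problem \<Rightarrow> 'a set" where
  "optimal_solutions Q = {x. is_arg_min (snd Q) (\<lambda>y. y \<in> fst Q) x}"

definition equivalent_under ::
  "('a \<Rightarrow> 'b) \<Rightarrow> 'a min_problem \<Rightarrow> 'b min_problem \<Rightarrow> bool" where
  "equivalent_under T Q R \<longleftrightarrow>
     bij_betw T (fst Q) (fst R) \<and> T ` optimal_solutions Q = optimal_solutions R"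

text \<open>
  The index set is the finite type \<open>'n\<close>, and \<open>\<le>\<close> on vectors is the componentwise order.
  Strict inequalities between vectors are always written out by components, since the library's
  \<open><\<close> on vectors does not mean strict inequality in every component.
\<close>

definition problem_P ::
  "real ^ 'n \<Rightarrow> real ^ 'n \<Rightarrow> real \<Rightarrow> (real ^ 'n) min_problem" where
  "problem_P w b c =
     ({x. (\<Sum>i\<in>UNIV. w $ i * x $ i) = c \<and> x \<le> b},
      \<lambda>x. \<Sum>i\<in>UNIV. w $ i * (x $ i)\<^sup>2)"

definition projection_problem ::
  "real ^ 'n \<Rightarrow> real ^ 'n \<Rightarrow> real \<Rightarrow> (real ^ 'n) min_problem" where
  "projection_problem w y a =
     ({z. (\<Sum>i\<in>UNIV. z $ i) = a \<and> 0 \<le> z},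
      \<lambda>z. 1 / 2 * (\<Sum>i\<in>UNIV. w $ i * (z $ i - y $ i)\<^sup>2))"

definition problem_CSP ::
  "real ^ 'n \<Rightarrow> real ^ 'n \<Rightarrow> (real ^ 'n) min_problem" where
  "problem_CSP p q =
     ({z. (\<Sum>i\<in>UNIV. z $ i) = 1 \<and> 0 \<le> z},
      \<lambda>z. (\<Sum>i\<in>UNIV. p $ i * (z $ i)\<^sup>2) + (\<Sum>i\<in>UNIV. q $ i * z $ i))"

end

theory Submission
  imports Defs
begin

text \<open>
  Both changes of variables are affine bijections of the feasible sets. The first carries the
  objective of (P) to half of itself. For the second, completing the square gives
  \<open>w\<^sub>i x\<^sub>i\<^sup>2 = (q\<^sub>i + 2 p\<^sub>i z\<^sub>i)\<^sup>2 / (2 p\<^sub>i) = 2 (p\<^sub>i z\<^sub>i\<^sup>2 + q\<^sub>i z\<^sub>i) + q\<^sub>i\<^sup>2 / (2 p\<^sub>i)\<close>,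
  so the objective is doubled and shifted by a constant. A strictly increasing
  affine change of the objective does not affect optimality.
\<close>

text \<open>Both halves reduce to this criterion: the explicit inverse \<open>S\<close> gives the
  bijection, and \<open>0 < k\<close> makes \<open>T\<close> preserve and reflect strict comparison
  of objective values among feasible points.\<close>

lemma equivalent_under_affineI:
  fixes k d :: real
  assumes T: "\<And>x. x \<in> fst Q \<Longrightarrow> T x \<in> fst R"
    and S: "\<And>y. y \<in> fst R \<Longrightarrow> S y \<in> fst Q"
    and ST: "\<And>x. x \<in> fst Q \<Longrightarrow> S (T x) = x"
    and TS: "\<And>y. y \<in> fst R \<Longrightarrow> T (S y) = y"
    and k: "0 < k"
    and objective: "\<And>x. x \<in> fst Q \<Longrightarrow> snd R (T x) = k * snd Q x + d"
  shows "equivalent_under T Q R"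
proof -
  have bij: "bij_betw T (fst Q) (fst R)"
    using T S ST TS by (intro bij_betwI[where g = S]) auto
  have less: "snd R (T x) < snd R (T y) \<longleftrightarrow> snd Q x < snd Q y"
    if "x \<in> fst Q" "y \<in> fst Q" for x y
    using k by (simp add: objective that)
  \<comment> \<open>Surjectivity matters here: a feasible point of \<open>R\<close> beating
    \<open>T x\<close> is the image of a feasible point of \<open>Q\<close>, which then beats
    \<open>x\<close>.\<close>
  have opt: "T x \<in> optimal_solutions R \<longleftrightarrow> x \<in> optimal_solutions Q" if "x \<in> fst Q" for x
    unfolding optimal_solutions_def is_arg_min_def mem_Collect_eq
    using that T less bij_betw_imp_surj_on[OF bij] by (metis imageE)
  have "T ` optimal_solutions Q = optimal_solutions R"
  proof (intro equalityI subsetI)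
    fix y assume "y \<in> T ` optimal_solutions Q"
    then show "y \<in> optimal_solutions R"
      using opt by (auto simp: optimal_solutions_def is_arg_min_def)
  next
    fix y assume y: "y \<in> optimal_solutions R"
    then have "y \<in> fst R"
      by (simp add: optimal_solutions_def is_arg_min_def)
    then show "y \<in> T ` optimal_solutions Q"
      using y S TS opt by (metis imageI)
  qed
  with bij show ?thesis
    by (simp add: equivalent_under_def)
qed

text \<open>The new variable is the slack of the bound scaled by a positive weight, hence
  nonnegativity. Its distance to \<open>w $ i * b $ i\<close> is \<open>- (w $ i * x $ i)\<close>,
  whose square divided by \<open>w $ i\<close> is the term of (P).\<close>

lemma problem_P_equivalent_projection_problem:
  fixes w b :: "real ^ 'n" and c :: real
  assumes w: "\<And>i. 0 < w $ i"
  shows "equivalent_under (\<lambda>x. \<chi> i. w $ i * (b $ i - x $ i)) (problem_P w b c)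
    (projection_problem (\<chi> i. 1 / w $ i) (\<chi> i. w $ i * b $ i) ((\<Sum>i\<in>UNIV. w $ i * b $ i) - c))"
\<comment> \<open>\<open>S\<close> solves the substitution for \<open>x\<close>; \<open>k\<close> is
  the factor in front of the projection objective.\<close>
proof (rule equivalent_under_affineI[where S = "\<lambda>z. \<chi> i. b $ i - z $ i / w $ i"
      and k = "1 / 2" and d = 0])
  have w0: "w $ i \<noteq> 0" for i
    using w[of i] by simp
  let ?R = "projection_problem (\<chi> i. 1 / w $ i) (\<chi> i. w $ i * b $ i)
    ((\<Sum>i\<in>UNIV. w $ i * b $ i) - c)"
  show "(\<chi> i. w $ i * (b $ i - x $ i)) \<in> fst ?R" if "x \<in> fst (problem_P w b c)" for x
    using that w
    by (simp add: problem_P_def projection_problem_def less_eq_vec_def right_diff_distrib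
        sum_subtractf mult_left_mono less_imp_le)
  show "(\<chi> i. b $ i - z $ i / w $ i) \<in> fst (problem_P w b c)" if "z \<in> fst ?R" for z
    using that w
    by (simp add: problem_P_def projection_problem_def less_eq_vec_def right_diff_distrib
        sum_subtractf w0 less_imp_le)
  show "(\<chi> i. b $ i - (\<chi> i. w $ i * (b $ i - x $ i)) $ i / w $ i) = x" for x
    by (simp add: vec_eq_iff w0)
  show "(\<chi> i. w $ i * (b $ i - (\<chi> i. b $ i - z $ i / w $ i) $ i)) = z" for z
    by (simp add: vec_eq_iff w0)
  have "1 / w $ i * (w $ i * (b $ i - x $ i) - w $ i * b $ i)\<^sup>2 = w $ i * (x $ i)\<^sup>2" for x i
    using w0[of i] by (simp add: field_simps power2_eq_square)
  then show "snd ?R (\<chi> i. w $ i * (b $ i - x $ i)) = 1 / 2 * snd (problem_P w b c) x + 0" for x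
    by (simp add: problem_P_def projection_problem_def)
qed simp

text \<open>The slack of the bound, \<open>- q $ i - x $ i\<close>, is
  \<open>2 * p $ i * z $ i\<close>, so the bound on \<open>x\<close> says that \<open>z\<close> is
  nonnegative.\<close>

lemma problem_CSP_equivalent_problem_P:
  fixes p q :: "real ^ 'n"
  assumes p: "\<And>i. 0 < p $ i"
  shows "equivalent_under (\<lambda>z. \<chi> i. - q $ i - 2 * p $ i * z $ i) (problem_CSP p q)
    (problem_P (\<chi> i. 1 / (2 * p $ i)) (\<chi> i. - q $ i) (- 1 - (\<Sum>i\<in>UNIV. q $ i / (2 * p $ i))))"
proof (rule equivalent_under_affineI[where S = "\<lambda>x. \<chi> i. - (q $ i / (2 * p $ i)) - x $ i / (2 * p $ i)"
      and k = 2 and d = "\<Sum>i\<in>UNIV. (q $ i)\<^sup>2 / (2 * p $ i)"])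
  have p0: "p $ i \<noteq> 0" for i
    using p[of i] by simp
  let ?T = "\<lambda>z. \<chi> i. - q $ i - 2 * p $ i * z $ i"
  let ?S = "\<lambda>x. \<chi> i. - (q $ i / (2 * p $ i)) - x $ i / (2 * p $ i)"
  let ?R = "problem_P (\<chi> i. 1 / (2 * p $ i)) (\<chi> i. - q $ i)
    (- 1 - (\<Sum>i\<in>UNIV. q $ i / (2 * p $ i)))"
  \<comment> \<open>The weight cancels the scaling of \<open>z\<close>. Summing this over the
    simplex produces exactly the constant \<open>c\<close> of (P).\<close>
  have constraint: "1 / (2 * p $ i) * (- q $ i - 2 * p $ i * t) = - (q $ i / (2 * p $ i)) - t"
    for i t
    using p0[of i] by (simp add: field_simps)
  show "?T z \<in> fst ?R" if "z \<in> fst (problem_CSP p q)" for z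
  proof -
    have "(\<Sum>i\<in>UNIV. 1 / (2 * p $ i) * (- q $ i - 2 * p $ i * z $ i))
        = - (\<Sum>i\<in>UNIV. q $ i / (2 * p $ i)) - (\<Sum>i\<in>UNIV. z $ i)"
      by (simp only: constraint sum_subtractf sum_negf)
    then show ?thesis
      using that p
      by (simp add: problem_P_def problem_CSP_def less_eq_vec_def less_imp_le)
  qed
  show "?S x \<in> fst (problem_CSP p q)" if "x \<in> fst ?R" for x
  proof -
    have "0 \<le> - (q $ i / (2 * p $ i)) - x $ i / (2 * p $ i)" for i
    proof -
      \<comment> \<open>Over the common denominator the numerator is the slack of the bound.\<close>
      have "0 \<le> (- q $ i - x $ i) / (2 * p $ i)"
        using that p[of i] by (simp add: problem_P_def less_eq_vec_def)
      then show ?thesis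
        by (simp add: diff_divide_distrib)
    qed
    then show ?thesis
      using that
      by (simp add: problem_P_def problem_CSP_def less_eq_vec_def sum_subtractf sum_negf)
  qed
  show "?S (?T z) = z" for z
    using p0 by (simp add: vec_eq_iff field_simps)
  show "?T (?S x) = x" for x
    using p0 by (simp add: vec_eq_iff field_simps)
  have "1 / (2 * p $ i) * (- q $ i - 2 * p $ i * z $ i)\<^sup>2
      = 2 * (p $ i * (z $ i)\<^sup>2) + 2 * (q $ i * z $ i) + (q $ i)\<^sup>2 / (2 * p $ i)" for z i
    using p0[of i] by (simp add: field_simps power2_eq_square)
  then show "snd ?R (?T z) = 2 * snd (problem_CSP p q) z + (\<Sum>i\<in>UNIV. (q $ i)\<^sup>2 / (2 * p $ i))"
    for z
    by (simp add: problem_P_def problem_CSP_def sum.distrib sum_distrib_left)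
qed simp

text \<open>The second half also certifies that the data are admissible for (P), so the first half
  applies to them, with \<open>a\<close> equal to 1.\<close>

theorem theorem2:
  shows
    "(\<forall>(w :: real ^ 'n) (b :: real ^ 'n) (c :: real).
        (\<forall>i. 0 < w $ i) \<and> c < (\<Sum>i\<in>UNIV. w $ i * b $ i) \<longrightarrow>
        (let w' = (\<chi> i. 1 / w $ i);
             y' = (\<chi> i. w $ i * b $ i);
             a = (\<Sum>i\<in>UNIV. w $ i * b $ i) - c
         in 0 < a \<and>
            equivalent_under (\<lambda>x. \<chi> i. w $ i * (b $ i - x $ i))
              (problem_P w b c) (projection_problem w' y' a)))
     \<and>
     (\<forall>(p :: real ^ 'n) (q :: real ^ 'n).
        (\<forall>i. 0 < p $ i) \<longrightarrow>
        (let w = (\<chi> i. 1 / (2 * p $ i));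
             b = (\<chi> i. - q $ i);
             c = - 1 - (\<Sum>i\<in>UNIV. q $ i / (2 * p $ i))
         in (\<forall>i. 0 < w $ i) \<and> c < (\<Sum>i\<in>UNIV. w $ i * b $ i) \<and>
            equivalent_under (\<lambda>z. \<chi> i. - q $ i - 2 * p $ i * z $ i)
              (problem_CSP p q) (problem_P w b c)))"
proof (intro conjI allI impI)
  fix w b :: "real ^ 'n" and c :: real
  assume "(\<forall>i. 0 < w $ i) \<and> c < (\<Sum>i\<in>UNIV. w $ i * b $ i)"
  then show "let w' = (\<chi> i. 1 / w $ i);
             y' = (\<chi> i. w $ i * b $ i);
             a = (\<Sum>i\<in>UNIV. w $ i * b $ i) - c
         in 0 < a \<and>
            equivalent_under (\<lambda>x. \<chi> i. w $ i * (b $ i - x $ i))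
              (problem_P w b c) (projection_problem w' y' a)"
    by (simp add: Let_def problem_P_equivalent_projection_problem)
next
  fix p q :: "real ^ 'n"
  assume p: "\<forall>i. 0 < p $ i"
  then show "let w = (\<chi> i. 1 / (2 * p $ i));
             b = (\<chi> i. - q $ i);
             c = - 1 - (\<Sum>i\<in>UNIV. q $ i / (2 * p $ i))
         in (\<forall>i. 0 < w $ i) \<and> c < (\<Sum>i\<in>UNIV. w $ i * b $ i) \<and>
            equivalent_under (\<lambda>z. \<chi> i. - q $ i - 2 * p $ i * z $ i)
              (problem_CSP p q) (problem_P w b c)"
    \<comment> \<open>The weighted sum of \<open>b\<close> is minus the sum of
      \<open>q $ i / (2 * p $ i)\<close>, which exceeds \<open>c\<close> by exactly 1.\<close>
    using problem_CSP_equivalent_problem_P[of p q] by (simp add: Let_def sum_negf)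
qed

end
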